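(* Let $\Pi_{42}$ be the map on $\mathbb{N}=\{1,2,3,\dots\}$ produced by the following procedure, with $L(m)=R(m)=\lfloor (m+1)/2\rfloor$. At step $1$ set $\Pi_{42}(1)=1$. For $m=2,3,4,\dots$ in turn, at step $m$: if $\Pi_{42}(m-L(m))$ has not been assigned at an earlier step, set $\Pi_{42}(m-L(m))=m$; otherwise set $\Pi_{42}(m+R(m))=m$. Let $n,k\ge1$ be natural numbers. Then: (a) $\Pi_{42}(n)$ never has type (I); (b) if $n=3k+1$ then $\Pi_{42}(n)$ has type (II); (c) if $n=3k+2$ then $\Pi_{42}(n)$ has type (III); (d) if $n=3k+3$ then $\Pi_{42}(n)$ has type (II) if $\Pi_{42}(k+1)$ has type (II), and $\Pi_{42}(n)$ has type (IV) if $\Pi_{42}(k+1)$ has type (III) or type (IV).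
   Context: The procedure assigns a value $\Pi_{42}(n)$ to every $n\in\mathbb{N}$. Types: $\Pi_{42}(n)$ has type (I) if $\Pi_{42}(n)>n$ and $\Pi_{42}(n)=2n+1$; type (II) if $\Pi_{42}(n)>n$ and $\Pi_{42}(n)=2n$; type (III) if $\Pi_{42}(n)<n$ and $\Pi_{42}(n)=(2n-1)/3$; type (IV) if $\Pi_{42}(n)<n$ and $\Pi_{42}(n)=2n/3$. *)

theory Defs
  imports Complex_Main
begin

definition L :: "nat \<Rightarrow> nat" where
  "L m = (m + 1) div 2"

definition R :: "nat \<Rightarrow> nat" where
  "R m = (m + 1) div 2"

(* The partial map after steps 1, ..., m; a position holds None as long as it is unassigned. *)
fun state42 :: "nat \<Rightarrow> nat \<Rightarrow> nat option" where
  "state42 0 = Map.empty"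
| "state42 (Suc 0) = [1 \<mapsto> 1]"
| "state42 (Suc (Suc j)) =
     (let m = Suc (Suc j); s = state42 (Suc j) in
      if s (m - L m) = None then s(m - L m \<mapsto> m) else s(m + R m \<mapsto> m))"

(* The value eventually standing at position n; the lemmas below show that it exists and
   is unique for every n \<ge> 1, i.e. that the description is proper. *)
definition Pi42 :: "nat \<Rightarrow> nat" where
  "Pi42 n = (THE v. \<forall>\<^sub>F m in sequentially. state42 m n = Some v)"

definition type_I :: "nat \<Rightarrow> bool" where
  "type_I n \<longleftrightarrow> Pi42 n > n \<and> Pi42 n = 2 * n + 1"

definition type_II :: "nat \<Rightarrow> bool" where
  "type_II n \<longleftrightarrow> Pi42 n > n \<and> Pi42 n = 2 * n"

definition type_III :: "nat \<Rightarrow> bool" where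
  "type_III n \<longleftrightarrow> Pi42 n < n \<and> real (Pi42 n) = (2 * real n - 1) / 3"

definition type_IV :: "nat \<Rightarrow> bool" where
  "type_IV n \<longleftrightarrow> Pi42 n < n \<and> real (Pi42 n) = 2 * real n / 3"

lemma state42_step:
  assumes "m \<ge> 1"
  shows "state42 (Suc m) =
    (if state42 m (Suc m - L (Suc m)) = None then (state42 m)(Suc m - L (Suc m) \<mapsto> Suc m)
     else (state42 m)(Suc m + R (Suc m) \<mapsto> Suc m))"
  using assms by (cases m) (auto simp: Let_def)

lemma state42_assigned:
  assumes "n \<ge> 1"
  shows "state42 (2 * n) n \<noteq> None"
proof -
  obtain m where m: "2 * n = Suc m" "m \<ge> 1"
    using assms by (cases "2 * n") auto
  have "Suc m - L (Suc m) = n"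
    unfolding m(1)[symmetric] L_def by simp
  then show ?thesis
    unfolding m(1) state42_step[OF m(2)] by auto
qed

lemma state42_stable:
  assumes "n \<ge> 1" "m \<ge> 2 * n + 1"
  shows "state42 m n = state42 (2 * n + 1) n"
  using assms(2)
proof (induction m rule: dec_induct)
  case (step m)
  have "n \<noteq> Suc m - L (Suc m)" "n \<noteq> Suc m + R (Suc m)" "m \<ge> 1"
    using step.hyps assms(1) unfolding L_def R_def by linarith+
  then show ?case
    using step.IH by (simp add: state42_step)
qed simp

lemma state42_assigned_stays:
  assumes "m \<ge> 1" "state42 m n \<noteq> None"
  shows "state42 (Suc m) n \<noteq> None"
  using assms by (auto simp: state42_step)

lemma Pi42_eventually:
  assumes "n \<ge> 1"
  shows "\<forall>\<^sub>F m in sequentially. state42 m n = Some (Pi42 n)"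
proof -
  have "state42 (2 * n + 1) n \<noteq> None"
    using state42_assigned_stays[OF _ state42_assigned[OF assms]] assms by simp
  then obtain v where "state42 (2 * n + 1) n = Some v"
    by auto
  then have "state42 m n = Some v" if "m \<ge> 2 * n + 1" for m
    using state42_stable[OF assms that] by simp
  then have *: "\<forall>\<^sub>F m in sequentially. state42 m n = Some v"
    by (rule eventually_sequentiallyI)
  have "w = v" if "\<forall>\<^sub>F m in sequentially. state42 m n = Some w" for w
  proof -
    from eventually_conj[OF * that] have "\<exists>m. state42 m n = Some v \<and> state42 m n = Some w"
      by (rule eventually_happens'[OF sequentially_bot])
    then show ?thesis
      by auto
  qed
  with * have "Pi42 n = v"
    unfolding Pi42_def by (intro the_equality)
  with * show ?thesis
    by simp
qed

end

theory Submission
  imports Defs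
begin

text \<open>Put \<open>j = m div 2\<close>. Step \<open>m\<close> inspects position \<open>j\<close>, and its fallback position is
  \<open>3 * j\<close> for even \<open>m\<close> and \<open>3 * j + 2\<close> for odd \<open>m\<close>. At odd \<open>m\<close>, position \<open>j\<close> has just been
  filled, so the value always goes to \<open>3 * j + 2\<close>. At even \<open>m\<close> it goes to \<open>3 * j\<close> exactly if
  \<open>j\<close> was filled earlier. Hence whether \<open>n\<close> is filled before step \<open>2 * n\<close> is governed by a
  recursion on \<open>n div 3\<close>, and this determines the value at \<open>n\<close>.\<close>

text \<open>Meant as: the position is filled before the step that inspects it.
  \<open>triple_plus_2\<close> and \<open>triple\<close> are the odd and even fallbacks. The guard
  \<open>j \<ge> 1\<close> keeps position 2 out, which is filled only at step 4.\<close>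

inductive early :: "nat \<Rightarrow> bool" where
  one: "early 1"
| triple_plus_2: "j \<ge> 1 \<Longrightarrow> early (3 * j + 2)"
| triple: "early j \<Longrightarrow> early (3 * j)"

text \<open>Truncating division merges types (III) and (IV): \<open>2 * n div 3\<close> is
  \<open>2 * j + 1\<close> at \<open>n = 3 * j + 2\<close> and \<open>2 * j\<close> at
  \<open>n = 3 * j\<close>. Position 1 is separate, since there the quotient would be 0.\<close>

definition val42 :: "nat \<Rightarrow> nat" where
  "val42 n = (if n = 1 then 1 else if early n then 2 * n div 3 else 2 * n)"

lemma early_mod_3: "early n \<Longrightarrow> n = 1 \<or> n mod 3 = 0 \<or> (n > 2 \<and> n mod 3 = 2)"
  by (erule early.cases) (presburger | simp)+

lemma early_triple_iff: "early (3 * j) \<longleftrightarrow> early j"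
proof
  assume "early (3 * j)"
  then show "early j"
    by cases (presburger | simp)+
qed (rule early.triple)

lemma not_early_triple_plus_1: "j \<ge> 1 \<Longrightarrow> \<not> early (3 * j + 1)"
  using early_mod_3[of "3 * j + 1"] by auto

lemma val42_less_double_iff: "n \<ge> 1 \<Longrightarrow> val42 n < 2 * n \<longleftrightarrow> early n"
  by (auto simp: val42_def early.one[simplified])

lemma val42_le_double: "n \<ge> 1 \<Longrightarrow> val42 n \<le> 2 * n"
  by (auto simp: val42_def)

text \<open>Inverts \<open>val42\<close> at even values; the unique preimage is the position that
  step \<open>2 * j\<close> writes to.\<close>

lemma val42_eq_even_iff:
  assumes "n \<ge> 1" "j \<ge> 1"
  shows "val42 n = 2 * j \<longleftrightarrow> n = (if early j then 3 * j else j)"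
proof
  assume v: "val42 n = 2 * j"
  then have n1: "n \<noteq> 1"
    by (auto simp: val42_def)
  show "n = (if early j then 3 * j else j)"
  proof (cases "early n")
    case True
    with v n1 have "2 * n div 3 = 2 * j"
      by (simp add: val42_def)
    \<comment> \<open>Residue 2 modulo 3 would make the quotient odd.\<close>
    with early_mod_3[OF True] n1 have "n = 3 * j"
      by presburger
    with True early_triple_iff show ?thesis
      by simp
  next
    case False
    with v n1 show ?thesis
      by (auto simp: val42_def)
  qed
next
  assume n: "n = (if early j then 3 * j else j)"
  show "val42 n = 2 * j"
    using n assms early_triple_iff[of j]
    by (cases "early j") (auto simp: val42_def early.one[simplified])
qed

lemma val42_eq_odd_iff:
  assumes "n \<ge> 1" "j \<ge> 1"
  shows "val42 n = 2 * j + 1 \<longleftrightarrow> n = 3 * j + 2"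
proof
  assume v: "val42 n = 2 * j + 1"
  then have n1: "n \<noteq> 1" "early n"
    using assms by (auto simp: val42_def split: if_splits) presburger
  with v have "2 * n div 3 = 2 * j + 1"
    by (simp add: val42_def)
  with early_mod_3[OF n1(2)] n1(1) show "n = 3 * j + 2"
    by presburger
next
  assume "n = 3 * j + 2"
  then show "val42 n = 2 * j + 1"
    using early.triple_plus_2[OF assms(2)] by (auto simp: val42_def)
qed

text \<open>Base case of the induction on steps: step 1 fills position 1 only.\<close>

lemma val42_eq_1_iff: "n \<ge> 1 \<Longrightarrow> val42 n = 1 \<longleftrightarrow> n = 1"
proof
  assume n: "n \<ge> 1" "val42 n = 1"
  show "n = 1"
  proof (rule ccontr)
    assume n1: "n \<noteq> 1"
    with n have e: "early n" and d: "2 * n div 3 = 1"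
      by (auto simp: val42_def split: if_splits)
    show False
      using early_mod_3[OF e] n1 n(1) d by presburger
  qed
qed (simp add: val42_def)

lemma val42_pos: "n \<ge> 1 \<Longrightarrow> val42 n \<ge> 1"
  by (auto simp: val42_def)

text \<open>Invariant of the procedure. Passing from \<open>m\<close> to \<open>Suc m\<close> adds
  the positions with value \<open>Suc m\<close>, and the preimage lemmas show that this is just the
  one position updated.\<close>

lemma state42_eq:
  assumes "m \<ge> 1"
  shows "state42 m = (\<lambda>n. if n \<ge> 1 \<and> val42 n \<le> m then Some (val42 n) else None)"
  using assms
proof (induction m rule: dec_induct)
  case base
  show ?case
  proof
    fix n
    show "state42 1 n = (if n \<ge> 1 \<and> val42 n \<le> 1 then Some (val42 n) else None)"
      using val42_eq_1_iff[of n] val42_pos[of n] by auto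
  qed
next
  case (step m)
  define j where "j = Suc m div 2"
  have j: "j \<ge> 1"
    using step.hyps by (simp add: j_def)
  have pos: "Suc m - L (Suc m) = j"
    unfolding L_def j_def by presburger
  show ?case
  proof (cases "even (Suc m)")
    case True
    then have m: "Suc m = 2 * j"
      by (simp add: j_def)
    then have fallback: "Suc m + R (Suc m) = 3 * j"
      by (simp add: R_def)
    \<comment> \<open>Since \<open>Suc m = 2 * j\<close>, the condition
      \<open>val42 j \<le> m\<close> means \<open>val42 j < 2 * j\<close>.\<close>
    have free: "state42 m j = None \<longleftrightarrow> \<not> early j"
      using j m val42_less_double_iff[of j] by (auto simp: step.IH)
    have upd: "state42 (Suc m) = (state42 m)((if early j then 3 * j else j) \<mapsto> Suc m)"
      using free by (simp only: state42_step[OF step.hyps(1)] pos fallback split: if_split) simp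
    show ?thesis
    proof
      fix n
      show "state42 (Suc m) n =
        (if n \<ge> 1 \<and> val42 n \<le> Suc m then Some (val42 n) else None)"
        unfolding upd step.IH
        using val42_eq_even_iff[of n j, folded m] j by (auto simp: le_Suc_eq)
    qed
  next
    case False
    then have m: "Suc m = 2 * j + 1"
      unfolding j_def by presburger
    then have fallback: "Suc m + R (Suc m) = 3 * j + 2"
      by (simp add: R_def)
    have "state42 m j \<noteq> None"
      unfolding step.IH using j m val42_le_double[of j] by auto
    then have upd: "state42 (Suc m) = (state42 m)(3 * j + 2 \<mapsto> Suc m)"
      by (simp only: state42_step[OF step.hyps(1)] pos fallback if_False)
    show ?thesis
    proof
      fix n
      show "state42 (Suc m) n =
        (if n \<ge> 1 \<and> val42 n \<le> Suc m then Some (val42 n) else None)"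
        unfolding upd step.IH
        using val42_eq_odd_iff[of n j, folded m] j by (auto simp: le_Suc_eq)
    qed
  qed
qed

text \<open>Two eventual values agree because some step \<open>m\<close> exhibits both.\<close>

lemma Pi42_eq_val42:
  assumes "n \<ge> 1"
  shows "Pi42 n = val42 n"
proof -
  have "\<forall>\<^sub>F m in sequentially. state42 m n = Some (val42 n)"
    using assms val42_pos[OF assms]
    by (intro eventually_sequentiallyI[of "val42 n"]) (simp add: state42_eq)
  from eventually_conj[OF this Pi42_eventually[OF assms]]
  have "\<exists>m. state42 m n = Some (val42 n) \<and> state42 m n = Some (Pi42 n)"
    by (rule eventually_happens'[OF sequentially_bot])
  then show ?thesis
    by auto
qed

lemma not_type_I: "n \<ge> 1 \<Longrightarrow> \<not> type_I n"
  using val42_le_double[of n] by (simp add: type_I_def Pi42_eq_val42)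

lemma type_II_iff: "n \<ge> 1 \<Longrightarrow> type_II n \<longleftrightarrow> \<not> early n"
  using val42_less_double_iff[of n] val42_le_double[of n]
  by (auto simp: type_II_def Pi42_eq_val42)

lemma type_III_triple_plus_2: "k \<ge> 1 \<Longrightarrow> type_III (3 * k + 2)"
  using val42_eq_odd_iff[of "3 * k + 2" k] by (simp add: type_III_def Pi42_eq_val42)

lemma type_IV_triple: "k \<ge> 1 \<Longrightarrow> early k \<Longrightarrow> type_IV (3 * k)"
  using val42_eq_even_iff[of "3 * k" k] by (simp add: type_IV_def Pi42_eq_val42)

text \<open>Either type puts the value below \<open>n\<close>, hence below \<open>2 * n\<close>,
  which characterizes \<open>early\<close>.\<close>

lemma early_if_type_III_or_IV:
  assumes "n \<ge> 1" "type_III n \<or> type_IV n"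
  shows "early n"
proof -
  have "val42 n < n"
    using assms by (auto simp: type_III_def type_IV_def Pi42_eq_val42)
  then show ?thesis
    using val42_less_double_iff[OF assms(1)] by simp
qed

theorem theorem6:
  fixes n k :: nat
  assumes "n \<ge> 1" and "k \<ge> 1"
  shows "\<not> type_I n
    \<and> (n = 3 * k + 1 \<longrightarrow> type_II n)
    \<and> (n = 3 * k + 2 \<longrightarrow> type_III n)
    \<and> (n = 3 * k + 3 \<longrightarrow>
         (type_II (k + 1) \<longrightarrow> type_II n)
         \<and> (type_III (k + 1) \<or> type_IV (k + 1) \<longrightarrow> type_IV n))"
proof (intro conjI impI)
  show "\<not> type_I n"
    using assms(1) by (rule not_type_I)
  show "type_II n" if "n = 3 * k + 1"
    using that assms not_early_triple_plus_1[of k] type_II_iff[of n] by simp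
  show "type_III n" if "n = 3 * k + 2"
    using that type_III_triple_plus_2[OF assms(2)] by simp
  assume "n = 3 * k + 3"
  then have n: "n = 3 * (k + 1)"
    by simp
  show "type_II n" if "type_II (k + 1)"
    using that assms(1) early_triple_iff[of "k + 1"] type_II_iff[of n] type_II_iff[of "k + 1"]
    unfolding n by simp
  show "type_IV n" if "type_III (k + 1) \<or> type_IV (k + 1)"
    using type_IV_triple[of "k + 1"] early_if_type_III_or_IV[OF _ that] unfolding n by simp
qed

end
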